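(* For every fixed graph $F$, \textsc{Strong $F$-closure} can be solved in time $2^{O(\ell)}\cdot n^{O(1)}$, where $\ell=|E(G)|-k$ for the input $(G,k)$ and $n=|V(G)|$.
   Context: All graphs are finite, simple and undirected. For graphs $H,F$, $H\simeq F$ means $H$ is isomorphic to $F$. Given a graph $G$ and a graph $F$, a (not necessarily induced) spanning subgraph $H$ of $G$ satisfies the $F$-closure if for every $S\subseteq V(H)$ with $H[S]\simeq F$ we have $G[S]\not\simeq F$. \textsc{Strong $F$-closure}: given a graph $G$ and a nonnegative integer $k$, decide whether $G$ has a spanning subgraph $H$ satisfying the $F$-closure with $|E(H)|\ge k$. *)

theory Defs
  imports Main
begin

datatype 'a graph = Graph (verts: "'a set") (edges: "'a set set")

definition simple_graph :: "'a graph \<Rightarrow> bool" where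
  "simple_graph G \<longleftrightarrow> finite (verts G) \<and> (\<forall>e \<in> edges G. e \<subseteq> verts G \<and> card e = 2)"

definition isomorphic :: "'a graph \<Rightarrow> 'b graph \<Rightarrow> bool" where
  "isomorphic G H \<longleftrightarrow>
     (\<exists>f. bij_betw f (verts G) (verts H) \<and>
          (\<forall>u \<in> verts G. \<forall>v \<in> verts G. {u, v} \<in> edges G \<longleftrightarrow> {f u, f v} \<in> edges H))"

definition induced_subgraph :: "'a graph \<Rightarrow> 'a set \<Rightarrow> 'a graph" where
  "induced_subgraph G S = Graph S {e \<in> edges G. e \<subseteq> S}"

definition spanning_subgraph :: "'a graph \<Rightarrow> 'a graph \<Rightarrow> bool" where
  "spanning_subgraph H G \<longleftrightarrow> simple_graph H \<and> verts H = verts G \<and> edges H \<subseteq> edges G"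

definition satisfies_closure :: "'b graph \<Rightarrow> 'a graph \<Rightarrow> 'a graph \<Rightarrow> bool" where
  "satisfies_closure F G H \<longleftrightarrow>
     (\<forall>S \<subseteq> verts H. isomorphic (induced_subgraph H S) F \<longrightarrow>
                     \<not> isomorphic (induced_subgraph G S) F)"

definition strong_closure :: "'b graph \<Rightarrow> 'a graph \<Rightarrow> nat \<Rightarrow> bool" where
  "strong_closure F G k \<longleftrightarrow>
     (\<exists>H. spanning_subgraph H G \<and> satisfies_closure F G H \<and> k \<le> card (edges H))"

text \<open>
  Algorithms are structured programs for a unit-cost random access machine over the natural
  numbers, with addition and truncated subtraction as the only arithmetic operations. (Unit-cost
  multiplication would make the machine too powerful: repeated squaring creates numbers of
  exponential length.) The memory is divided into banks: state \<open>s\<close> holds the value \<open>s b i\<close> in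
  cell \<open>i\<close> of bank \<open>b\<close>. The bank is a constant in the program text and the index is computed, so
  a program uses finitely many banks, and interleaving them yields a machine with one memory and
  indirect addressing.
\<close>

type_synonym state = "nat \<Rightarrow> nat \<Rightarrow> nat"

datatype exp = Const nat | Cell nat exp | Add exp exp | Sub exp exp

fun eval :: "exp \<Rightarrow> state \<Rightarrow> nat" where
  "eval (Const m) s = m"
| "eval (Cell b e) s = s b (eval e s)"
| "eval (Add e1 e2) s = eval e1 s + eval e2 s"
| "eval (Sub e1 e2) s = eval e1 s - eval e2 s"

fun exp_cost :: "exp \<Rightarrow> nat" where
  "exp_cost (Const m) = 1"
| "exp_cost (Cell b e) = 1 + exp_cost e"
| "exp_cost (Add e1 e2) = 1 + exp_cost e1 + exp_cost e2"
| "exp_cost (Sub e1 e2) = 1 + exp_cost e1 + exp_cost e2"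

datatype com =
    Skip
  | Assign nat exp exp  \<comment> \<open>bank, index, value\<close>
  | Seq com com
  | Branch exp com com
  | Loop exp com

definition update :: "nat \<Rightarrow> nat \<Rightarrow> nat \<Rightarrow> state \<Rightarrow> state" where
  "update b i v s = s(b := (s b)(i := v))"

text \<open>
  \<open>exec c s t s'\<close>: started in \<open>s\<close>, program \<open>c\<close> halts after \<open>t\<close> steps in \<open>s'\<close>. A condition holds if its value is nonzero.
\<close>

inductive exec :: "com \<Rightarrow> state \<Rightarrow> nat \<Rightarrow> state \<Rightarrow> bool" where
  Skip: "exec Skip s 1 s"
| Assign: "exec (Assign b i e) s (1 + exp_cost i + exp_cost e) (update b (eval i s) (eval e s) s)"
| Seq: "exec c1 s t1 s1 \<Longrightarrow> exec c2 s1 t2 s2 \<Longrightarrow> exec (Seq c1 c2) s (t1 + t2) s2"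
| BranchTrue: "eval e s \<noteq> 0 \<Longrightarrow> exec c1 s t s1 \<Longrightarrow> exec (Branch e c1 c2) s (1 + exp_cost e + t) s1"
| BranchFalse: "eval e s = 0 \<Longrightarrow> exec c2 s t s1 \<Longrightarrow> exec (Branch e c1 c2) s (1 + exp_cost e + t) s1"
| LoopFalse: "eval e s = 0 \<Longrightarrow> exec (Loop e c) s (1 + exp_cost e) s"
| LoopTrue: "eval e s \<noteq> 0 \<Longrightarrow> exec c s t1 s1 \<Longrightarrow> exec (Loop e c) s1 t2 s2 \<Longrightarrow>
    exec (Loop e c) s (1 + exp_cost e + t1 + t2) s2"

inductive_cases exec_elims:
  "exec Skip s t s'"
  "exec (Assign b i e) s t s'"
  "exec (Seq c1 c2) s t s'"
  "exec (Branch e c1 c2) s t s'"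

inductive_cases Loop_elim: "exec (Loop e c) s t s'"

lemma exec_deterministic: "exec c s t s' \<Longrightarrow> exec c s u s'' \<Longrightarrow> u = t \<and> s'' = s'"
proof (induction arbitrary: u s'' rule: exec.induct)
  case (Seq c1 s t1 s1 c2 t2 s2)
  from Seq.prems obtain u1 u2 r where "exec c1 s u1 r" "exec c2 r u2 s''" "u = u1 + u2"
    by (rule exec_elims(3))
  with Seq.IH show ?case by metis
next
  case (LoopFalse e s c)
  from LoopFalse.prems show ?case by (rule Loop_elim) (use LoopFalse.hyps in simp_all)
next
  case (LoopTrue e s c t1 s1 t2 s2)
  from LoopTrue.prems obtain u1 u2 r where
    "exec c s u1 r" "exec (Loop e c) r u2 s''" "u = 1 + exp_cost e + u1 + u2"
    by (rule Loop_elim) (use LoopTrue.hyps(1) in \<open>simp_all\<close>)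
  with LoopTrue.IH show ?case by metis
next
  case (BranchTrue e s c1 t s1 c2)
  from BranchTrue.prems show ?case
    by (rule exec_elims(4)) (use BranchTrue.hyps(1) BranchTrue.IH in simp_all)
next
  case (BranchFalse e s c2 t s1 c1)
  from BranchFalse.prems show ?case
    by (rule exec_elims(4)) (use BranchFalse.hyps(1) BranchFalse.IH in simp_all)
qed (auto elim: exec_elims(1,2))

text \<open>
  An instance \<open>(G, k)\<close> whose vertices are \<open>0, \<dots>, n - 1\<close> is presented with \<open>n\<close> in cell 0 of bank 0,
  \<open>k\<close> in cell 0 of bank 1, and the adjacency matrix, row by row, in the first \<open>n * n\<close> cells of
  bank 2; all other cells are 0. On the diagonal the set below is a singleton, hence not an edge.
\<close>

definition input :: "nat graph \<Rightarrow> nat \<Rightarrow> state" where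
  "input G k = (let n = card (verts G) in
     (\<lambda>b i. if b = 0 \<and> i = 0 then n
            else if b = 1 \<and> i = 0 then k
            else if b = 2 \<and> i < n * n \<and> {i div n, i mod n} \<in> edges G then 1
            else 0))"

text \<open>The answer is read from cell 0 of bank 0: 1 for yes and 0 for no.\<close>

definition decides_within ::
    "com \<Rightarrow> (nat graph \<Rightarrow> nat \<Rightarrow> bool) \<Rightarrow> (nat graph \<Rightarrow> nat \<Rightarrow> nat) \<Rightarrow> bool" where
  "decides_within P Q T \<longleftrightarrow>
     (\<forall>G k. simple_graph G \<and> verts G = {..<card (verts G)} \<longrightarrow>
        (\<exists>t s. exec P (input G k) t s \<and> s 0 0 = (if Q G k then 1 else 0) \<and> t \<le> T G k))"

end

theory Submission
  imports Defs
begin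

text \<open>
  If \<open>G[S]\<close> and \<open>H[S]\<close> are both copies of \<open>F\<close>, they have equally many edges and hence coincide. So
  the edges missing in \<open>H\<close> are a hitting set, of size at most \<open>\<ell> = |E(G)| - k\<close>, for the edge sets of
  the induced copies of \<open>F\<close> in \<open>G\<close>. Each of these sets has \<open>f = |E(F)|\<close> elements, so that the
  usual search tree solves the problem: take a copy that is not hit and branch over its edges. The
  tree is searched without recursion. Every number below \<open>B ^ \<ell>\<close>, where \<open>B = 2 ^ (f + 1)\<close>, encodes
  a list of \<open>\<ell>\<close> choices; with the choices fixed, one pass over all \<open>|V(F)|\<close>-tuples of vertices
  suffices, because a copy stays hit once it is.
\<close>

subsection \<open>Bounded hitting sets\<close>

text \<open>
  The number \<open>y\<close> is a list of choices, written in base \<open>B\<close> with the next choice in the last digit: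
  digit \<open>d \<ge> 1\<close> puts element \<open>d - 1\<close> of the set \<open>h\<close> that is not hit yet into \<open>D\<close>, every other digit means
  failure. Digit 0 is what an exhausted list yields, so a number below \<open>B ^ l\<close> allows at most \<open>l\<close>
  choices.
\<close>

fun hit_step :: "nat \<Rightarrow> 'e list \<Rightarrow> nat \<times> 'e set \<times> bool \<Rightarrow> nat \<times> 'e set \<times> bool" where
  "hit_step B h (y, D, failed) =
    (if set h \<inter> D \<noteq> {} then (y, D, failed)
     else if 1 \<le> y mod B \<and> y mod B \<le> length h
       then (y div B, insert (h ! (y mod B - 1)) D, failed)
       else (y div B, D, True))"

lemma hit_step_failed: "snd (snd st) \<Longrightarrow> snd (snd (hit_step B h st))"
  by (cases st) auto

lemma fold_hit_step_failed: "snd (snd st) \<Longrightarrow> snd (snd (fold (hit_step B) hs st))"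
  by (induction hs arbitrary: st) (auto simp del: hit_step.simps simp: hit_step_failed)

text \<open>The failure flag is never reset, so a final \<open>False\<close> excludes failure at
  every step. Each insertion then uses up a nonzero digit, and a number below \<open>B ^ l\<close>
  has at most \<open>l\<close> of them. \<open>D\<close> only grows, so a set once hit stays
  hit.\<close>

lemma fold_hit_step_sound:
  assumes "fold (hit_step B) hs (y, D, False) = (y', D', False)" "finite D" "y < B ^ l"
  shows "finite D' \<and> D \<subseteq> D' \<and> card D' \<le> card D + l \<and> (\<forall>h \<in> set hs. set h \<inter> D' \<noteq> {})"
  using assms
proof (induction hs arbitrary: y D l)
  case Nil
  then show ?case by simp
next
  case (Cons h hs)
  show ?case
  proof (cases "set h \<inter> D = {}")
    case False
    then have "fold (hit_step B) hs (y, D, False) = (y', D', False)" using Cons.prems(1) by simp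
    from Cons.IH[OF this Cons.prems(2,3)] show ?thesis using False by auto
  next
    case True
    have digit: "1 \<le> y mod B \<and> y mod B \<le> length h"
    proof (rule ccontr)
      assume "\<not> ?thesis"
      then have "fold (hit_step B) hs (y div B, D, True) = (y', D', False)"
        using Cons.prems(1) True by auto
      then show False using fold_hit_step_failed[of "(y div B, D, True)" B hs] by simp
    qed
    let ?e = "h ! (y mod B - 1)"
    have e: "?e \<in> set h" using digit by auto
    have run: "fold (hit_step B) hs (y div B, insert ?e D, False) = (y', D', False)"
      using Cons.prems(1) True digit by simp
    \<comment> \<open>For \<open>l = 0\<close> the bound would force \<open>y = 0\<close>, whose
      last digit is 0, contrary to \<open>digit\<close>.\<close>
    obtain l' where l: "l = Suc l'"
      using digit Cons.prems(3) by (cases l) auto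
    have "y div B < B ^ l'"
      using Cons.prems(3) by (simp add: l less_mult_imp_div_less mult.commute)
    from Cons.IH[OF run _ this] have *: "finite D'" "insert ?e D \<subseteq> D'"
      "card D' \<le> card (insert ?e D) + l'" "\<forall>h \<in> set hs. set h \<inter> D' \<noteq> {}"
      using Cons.prems(2) by auto
    have "card (insert ?e D) \<le> Suc (card D)" by (rule card_insert_le_m1) auto
    then show ?thesis using * e l by auto
  qed
qed

text \<open>A known hitting set \<open>X\<close> guides the choices: every set not yet hit contains
  an element of \<open>X\<close>, so \<open>D\<close> stays inside \<open>X\<close> and
  \<open>card (X - D)\<close> drops with each choice.\<close>

lemma fold_hit_step_complete:
  assumes "finite X" "D \<subseteq> X" "\<forall>h \<in> set hs. set h \<inter> X \<noteq> {} \<and> length h < B" "0 < B"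
  shows "\<exists>y < B ^ card (X - D). \<not> snd (snd (fold (hit_step B) hs (y, D, False)))"
  using assms(2,3)
proof (induction hs arbitrary: D)
  case Nil
  then show ?case using assms(4) by (intro exI[of _ 0]) simp
next
  case (Cons h hs)
  show ?case
  proof (cases "set h \<inter> D = {}")
    case False
    then show ?thesis using Cons by simp
  next
    case True
    from Cons.prems obtain e where e: "e \<in> set h" "e \<in> X" by auto
    then obtain d where d: "d < length h" "h ! d = e" by (auto simp: in_set_conv_nth)
    have "e \<notin> D" using True e by auto
    obtain y where y: "y < B ^ card (X - insert e D)"
      "\<not> snd (snd (fold (hit_step B) hs (y, insert e D, False)))"
      using Cons.IH[of "insert e D"] Cons.prems e by auto
    have B: "Suc d < B" using d Cons.prems by auto
    have card: "card (X - D) = Suc (card (X - insert e D))"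
      using assms(1) e \<open>e \<notin> D\<close>
      by (metis Diff_iff Diff_insert card_Suc_Diff1 finite_Diff)
    \<comment> \<open>Position \<open>d\<close> gets the digit \<open>d + 1\<close>, as 0 means
      failure; it is attached as new last digit to the number \<open>y\<close> of the later
      choices.\<close>
    have "Suc d + B * y < B * Suc y" using B by simp
    also have "\<dots> \<le> B * B ^ card (X - insert e D)" using y(1) by (intro mult_le_mono2) simp
    finally have "Suc d + B * y < B ^ card (X - D)" by (simp add: card)
    moreover have "(Suc d + B * y) mod B = Suc d" "(Suc d + B * y) div B = y"
      using B by (simp_all add: div_add1_eq del: add_Suc)
    ultimately show ?thesis using True d y(2) by (intro exI[of _ "Suc d + B * y"]) simp
  qed
qed

lemma bounded_hitting_set_iff:
  assumes "\<forall>h \<in> set hs. length h < B" "0 < B"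
  shows "(\<exists>x < B ^ l. \<not> snd (snd (fold (hit_step B) hs (x, {}, False)))) \<longleftrightarrow>
    (\<exists>D. finite D \<and> card D \<le> l \<and> (\<forall>h \<in> set hs. set h \<inter> D \<noteq> {}))"
proof
  assume "\<exists>x < B ^ l. \<not> snd (snd (fold (hit_step B) hs (x, {}, False)))"
  then obtain x y D where "x < B ^ l" "fold (hit_step B) hs (x, {}, False) = (y, D, False)"
    by (metis prod.collapse)
  from fold_hit_step_sound[OF this(2) _ this(1)]
  show "\<exists>D. finite D \<and> card D \<le> l \<and> (\<forall>h \<in> set hs. set h \<inter> D \<noteq> {})" by auto
next
  assume "\<exists>D. finite D \<and> card D \<le> l \<and> (\<forall>h \<in> set hs. set h \<inter> D \<noteq> {})"
  then obtain D where D: "finite D" "card D \<le> l" "\<forall>h \<in> set hs. set h \<inter> D \<noteq> {}" by auto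
  then obtain x where "x < B ^ card D" "\<not> snd (snd (fold (hit_step B) hs (x, {}, False)))"
    using fold_hit_step_complete[of D "{}" hs B] assms by auto
  moreover have "B ^ card D \<le> B ^ l" using D(2) assms(2) by (intro power_increasing) auto
  ultimately show "\<exists>x < B ^ l. \<not> snd (snd (fold (hit_step B) hs (x, {}, False)))"
    by (meson order_less_le_trans)
qed

subsection \<open>Strong closure as a hitting set problem\<close>

lemma edge_obtain:
  assumes "simple_graph G" "e \<in> edges G"
  obtains u v where "e = {u, v}" "u \<noteq> v" "u \<in> verts G" "v \<in> verts G"
  using assms unfolding simple_graph_def by (metis card_2_iff insert_subset)

lemma finite_edges: "simple_graph G \<Longrightarrow> finite (edges G)"
  unfolding simple_graph_def by (rule finite_subset[of _ "Pow (verts G)"]) auto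

lemma simple_induced_subgraph:
  "simple_graph G \<Longrightarrow> S \<subseteq> verts G \<Longrightarrow> simple_graph (induced_subgraph G S)"
  unfolding simple_graph_def induced_subgraph_def by (auto intro: finite_subset)

text \<open>Taking images under the vertex bijection is a bijection between the edge sets. This will
  turn an inclusion between two copies of \<open>F\<close> into an equality.\<close>

lemma isomorphic_card_edges:
  assumes "simple_graph G" "simple_graph H" "isomorphic G H"
  shows "card (edges G) = card (edges H)"
proof -
  obtain f where f: "bij_betw f (verts G) (verts H)"
    "\<And>u v. u \<in> verts G \<Longrightarrow> v \<in> verts G \<Longrightarrow> {u, v} \<in> edges G \<longleftrightarrow> {f u, f v} \<in> edges H"
    using assms(3) unfolding isomorphic_def by auto
  have "bij_betw ((`) f) (edges G) (edges H)"
  proof (rule bij_betw_imageI)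
    show "inj_on ((`) f) (edges G)"
      using f(1) assms(1) unfolding bij_betw_def simple_graph_def
      by (intro inj_on_subset[OF inj_on_image_Pow[of f "verts G"]]) auto
    show "(`) f ` edges G = edges H"
    proof (intro equalityI subsetI)
      fix e assume "e \<in> (`) f ` edges G"
      then obtain d where d: "d \<in> edges G" "e = f ` d" by auto
      obtain u v where "d = {u, v}" "u \<in> verts G" "v \<in> verts G"
        by (rule edge_obtain[OF assms(1) d(1)])
      then show "e \<in> edges H" using f(2) d by auto
    next
      fix e assume e: "e \<in> edges H"
      then obtain u v where uv: "e = {u, v}" "u \<in> verts H" "v \<in> verts H"
        by (auto elim!: edge_obtain[OF assms(2)])
      then obtain u' v' where "u = f u'" "v = f v'" "u' \<in> verts G" "v' \<in> verts G"
        using f(1) unfolding bij_betw_def by blast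
      then have "{u', v'} \<in> edges G" "e = f ` {u', v'}" using f(2) e uv by auto
      then show "e \<in> (`) f ` edges G" by blast
    qed
  qed
  then show ?thesis by (rule bij_betw_same_card)
qed

text \<open>An enumeration of an induced copy. By symmetry and the absence of loops the pairs
  \<open>i < j\<close> determine the induced subgraph, and their number depends on \<open>q\<close>
  alone.\<close>

definition is_copy :: "nat \<Rightarrow> (nat \<times> nat) list \<Rightarrow> 'a graph \<Rightarrow> 'a list \<Rightarrow> bool" where
  "is_copy q es G vs \<longleftrightarrow> (\<forall>i j. i < j \<longrightarrow> j < q \<longrightarrow>
     vs ! i \<noteq> vs ! j \<and> ({vs ! i, vs ! j} \<in> edges G \<longleftrightarrow> (i, j) \<in> set es))"

definition copy_edges :: "(nat \<times> nat) list \<Rightarrow> 'a list \<Rightarrow> 'a set list" where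
  "copy_edges es vs = map (\<lambda>(i, j). {vs ! i, vs ! j}) es"

text \<open>Numbering the vertices of \<open>F\<close> turns the fixed graph into data that can be
  built into a program text.\<close>

definition represents :: "nat \<Rightarrow> (nat \<times> nat) list \<Rightarrow> 'b graph \<Rightarrow> bool" where
  "represents q es F \<longleftrightarrow> (\<exists>w. bij_betw w {..<q} (verts F) \<and>
     set es = {(i, j). i < j \<and> j < q \<and> {w i, w j} \<in> edges F})"

lemma represents_exists:
  assumes "simple_graph F"
  shows "\<exists>q es. represents q es F"
proof -
  obtain w where w: "bij_betw w {..<card (verts F)} (verts F)"
    using assms ex_bij_betw_nat_finite[of "verts F"]
    unfolding simple_graph_def by (auto simp: atLeast0LessThan)
  let ?E = "{(i, j). i < j \<and> j < card (verts F) \<and> {w i, w j} \<in> edges F}"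
  have "finite ?E"
    by (rule finite_subset[of _ "{..<card (verts F)} \<times> {..<card (verts F)}"]) auto
  then obtain es where "set es = ?E" using finite_list by blast
  then show ?thesis using w unfolding represents_def by blast
qed

lemma is_copy_isomorphic:
  assumes G: "simple_graph G" and F: "simple_graph F" and rep: "represents q es F"
    and vs: "length vs = q" "set vs \<subseteq> verts G" "is_copy q es G vs"
  shows "isomorphic (induced_subgraph G (set vs)) F"
proof -
  obtain w where w: "bij_betw w {..<q} (verts F)"
    "set es = {(i, j). i < j \<and> j < q \<and> {w i, w j} \<in> edges F}"
    using rep unfolding represents_def by blast
  have no_loop: "{u} \<notin> edges G" "{x} \<notin> edges F" for u x
    using G F unfolding simple_graph_def by fastforce+
  have "distinct vs"
    using vs(1,3) unfolding distinct_conv_nth is_copy_def by (metis linorder_neqE_nat)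
  then have nth: "bij_betw ((!) vs) {..<q} (set vs)"
    using vs(1) by (intro bij_betw_nth) auto
  have less: "{vs ! i, vs ! j} \<in> edges G \<longleftrightarrow> {w i, w j} \<in> edges F" if "i < j" "j < q" for i j
    using that vs(3) w(2) unfolding is_copy_def by auto
  \<comment> \<open>For \<open>i > j\<close> the pair is swapped; for \<open>i = j\<close> both
    sides are false because there are no loops.\<close>
  have edge: "{vs ! i, vs ! j} \<in> edges G \<longleftrightarrow> {w i, w j} \<in> edges F" if "i < q" "j < q" for i j
    using that less[of i j] less[of j i] no_loop
    by (cases i j rule: linorder_cases) (simp_all add: insert_commute)
  let ?g = "inv_into {..<q} ((!) vs)"
  have g: "bij_betw ?g (set vs) {..<q}" by (rule bij_betw_inv_into[OF nth])
  have "bij_betw (w \<circ> ?g) (set vs) (verts F)" by (rule bij_betw_trans[OF g w(1)])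
  moreover have "{u, v} \<in> edges G \<longleftrightarrow> {w (?g u), w (?g v)} \<in> edges F"
    if "u \<in> set vs" "v \<in> set vs" for u v
  proof -
    have "?g u < q" "?g v < q" using g that unfolding bij_betw_def by auto
    moreover have "vs ! ?g u = u" "vs ! ?g v = v"
      using bij_betw_inv_into_right[OF nth] that by auto
    ultimately show ?thesis using edge[of "?g u" "?g v"] by simp
  qed
  ultimately show ?thesis
    unfolding isomorphic_def induced_subgraph_def by (intro exI[of _ "w \<circ> ?g"]) auto
qed

lemma isomorphic_is_copy:
  assumes rep: "represents q es F" and iso: "isomorphic (induced_subgraph G S) F"
  obtains vs where "length vs = q" "set vs = S" "is_copy q es G vs"
proof -
  obtain w where w: "bij_betw w {..<q} (verts F)"
    "set es = {(i, j). i < j \<and> j < q \<and> {w i, w j} \<in> edges F}"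
    using rep unfolding represents_def by blast
  obtain f where f: "bij_betw f S (verts F)"
    "\<And>u v. u \<in> S \<Longrightarrow> v \<in> S \<Longrightarrow> {u, v} \<in> edges G \<longleftrightarrow> {f u, f v} \<in> edges F"
    using iso unfolding isomorphic_def induced_subgraph_def by auto
  let ?g = "inv_into S f \<circ> w"
  have g: "bij_betw ?g {..<q} S"
    by (rule bij_betw_trans[OF w(1) bij_betw_inv_into[OF f(1)]])
  let ?vs = "map ?g [0..<q]"
  have "set ?vs = S" using g unfolding bij_betw_def by (simp add: atLeast0LessThan)
  moreover have "is_copy q es G ?vs"
    unfolding is_copy_def
  proof (intro allI impI)
    fix i j assume ij: "i < j" "j < q"
    have S: "?g i \<in> S" "?g j \<in> S" and neq: "?g i \<noteq> ?g j"
      using g ij unfolding bij_betw_def inj_on_def by (auto simp del: comp_apply)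
    have "w i \<in> verts F" "w j \<in> verts F" using bij_betw_apply[OF w(1)] ij by auto
    then have "f (?g i) = w i" "f (?g j) = w j"
      using bij_betw_inv_into_right[OF f(1)] by auto
    with f(2)[OF S] neq ij w(2)
    show "?vs ! i \<noteq> ?vs ! j \<and> ({?vs ! i, ?vs ! j} \<in> edges G \<longleftrightarrow> (i, j) \<in> set es)" by simp
  qed
  ultimately show ?thesis using that[of ?vs] by simp
qed

lemma copy_edges_iff:
  assumes G: "simple_graph G" and rep: "represents q es F"
    and vs: "length vs = q" "is_copy q es G vs"
  shows "set (copy_edges es vs) = edges (induced_subgraph G (set vs))"
proof (intro equalityI subsetI)
  fix e assume "e \<in> set (copy_edges es vs)"
  then obtain i j where "(i, j) \<in> set es" "e = {vs ! i, vs ! j}"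
    unfolding copy_edges_def by auto
  moreover from this rep have "i < j" "j < q" unfolding represents_def by auto
  ultimately show "e \<in> edges (induced_subgraph G (set vs))"
    using vs unfolding is_copy_def induced_subgraph_def by auto
next
  fix e assume e: "e \<in> edges (induced_subgraph G (set vs))"
  then have "e \<in> edges G" "e \<subseteq> set vs" unfolding induced_subgraph_def by auto
  then obtain u v where "e = {u, v}" "u \<noteq> v" "u \<in> set vs" "v \<in> set vs"
    using edge_obtain[OF G] by (metis insert_subset)
  then obtain i j where ij: "i < q" "j < q" "i \<noteq> j" "e = {vs ! i, vs ! j}"
    using vs(1) by (metis in_set_conv_nth)
  then obtain i j where "i < j" "j < q" "e = {vs ! i, vs ! j}"
    by (metis insert_commute linorder_neqE_nat)
  moreover from this have "(i, j) \<in> set es"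
    using vs(2) \<open>e \<in> edges G\<close> unfolding is_copy_def by metis
  ultimately show "e \<in> set (copy_edges es vs)" unfolding copy_edges_def by force
qed

text \<open>\<open>D\<close> plays the role of the edges missing in \<open>H\<close>. The condition
  on \<open>k\<close> is stated separately because the truncated difference is 0 when
  \<open>k\<close> is too large.\<close>

lemma strong_closure_iff_hitting_set:
  assumes G: "simple_graph G" and F: "simple_graph F" and rep: "represents q es F"
  shows "strong_closure F G k \<longleftrightarrow> k \<le> card (edges G) \<and>
    (\<exists>D. finite D \<and> card D \<le> card (edges G) - k \<and>
      (\<forall>vs. length vs = q \<longrightarrow> set vs \<subseteq> verts G \<longrightarrow> is_copy q es G vs \<longrightarrow>
        set (copy_edges es vs) \<inter> D \<noteq> {}))"
    (is "_ \<longleftrightarrow> _ \<and> (\<exists>D. ?hit D)")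
proof
  assume "strong_closure F G k"
  then obtain H where H: "spanning_subgraph H G" "satisfies_closure F G H" "k \<le> card (edges H)"
    unfolding strong_closure_def by auto
  then have sub: "edges H \<subseteq> edges G" "verts H = verts G" unfolding spanning_subgraph_def by auto
  have "card (edges H) \<le> card (edges G)" by (rule card_mono[OF finite_edges[OF G] sub(1)])
  moreover have "card (edges G - edges H) \<le> card (edges G) - k"
    using H(3) sub(1) finite_edges[OF G] by (subst card_Diff_subset) (auto intro: finite_subset)
  moreover have "set (copy_edges es vs) \<inter> (edges G - edges H) \<noteq> {}"
    if vs: "length vs = q" "set vs \<subseteq> verts G" "is_copy q es G vs" for vs
  proof
    assume "set (copy_edges es vs) \<inter> (edges G - edges H) = {}"
    \<comment> \<open>A copy with no missing edge survives unchanged in \<open>H\<close>, against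
      the closure.\<close>
    then have "induced_subgraph H (set vs) = induced_subgraph G (set vs)"
      using copy_edges_iff[OF G rep vs(1,3)] sub(1) unfolding induced_subgraph_def by auto
    with is_copy_isomorphic[OF G F rep vs] H(2) vs(2) sub(2) show False
      unfolding satisfies_closure_def by auto
  qed
  ultimately show "k \<le> card (edges G) \<and> (\<exists>D. ?hit D)"
    using H(3) finite_edges[OF G] by (intro conjI exI[of _ "edges G - edges H"]) auto
next
  assume "k \<le> card (edges G) \<and> (\<exists>D. ?hit D)"
  then obtain D where k: "k \<le> card (edges G)" and D: "finite D" "card D \<le> card (edges G) - k"
    "\<And>vs. length vs = q \<Longrightarrow> set vs \<subseteq> verts G \<Longrightarrow> is_copy q es G vs \<Longrightarrow>
        set (copy_edges es vs) \<inter> D \<noteq> {}"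
    by auto
  define H where "H = Graph (verts G) (edges G - D)"
  have span: "spanning_subgraph H G"
    using G unfolding H_def spanning_subgraph_def simple_graph_def by auto
  have "satisfies_closure F G H"
    unfolding satisfies_closure_def
  proof (intro allI impI notI)
    fix S
    assume S: "S \<subseteq> verts H" and HF: "isomorphic (induced_subgraph H S) F"
      and GF: "isomorphic (induced_subgraph G S) F"
    have S': "S \<subseteq> verts G" using S unfolding H_def by simp
    have simple: "simple_graph (induced_subgraph G S)" "simple_graph (induced_subgraph H S)"
      using simple_induced_subgraph G S S' span unfolding spanning_subgraph_def by auto
    \<comment> \<open>\<open>H[S]\<close> lies inside \<open>G[S]\<close> and, both being copies of
      \<open>F\<close>, has as many edges. So no edge of \<open>G[S]\<close> was deleted, although
      \<open>D\<close> hits this set.\<close>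
    have "edges (induced_subgraph H S) = edges (induced_subgraph G S)"
    proof (rule card_subset_eq[OF finite_edges[OF simple(1)]])
      show "edges (induced_subgraph H S) \<subseteq> edges (induced_subgraph G S)"
        unfolding H_def induced_subgraph_def by auto
      show "card (edges (induced_subgraph H S)) = card (edges (induced_subgraph G S))"
        using isomorphic_card_edges[OF simple(1) F GF] isomorphic_card_edges[OF simple(2) F HF]
        by simp
    qed
    moreover obtain vs where vs: "length vs = q" "set vs = S" "is_copy q es G vs"
      by (rule isomorphic_is_copy[OF rep GF])
    moreover have "set (copy_edges es vs) \<inter> D \<noteq> {}" using D(3) vs S' by auto
    ultimately show False
      using copy_edges_iff[OF G rep vs(1,3)] unfolding H_def induced_subgraph_def by auto
  qed
  \<comment> \<open>\<open>D\<close> may contain sets that are not edges of \<open>G\<close>, so the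
    number of remaining edges is only bounded from below.\<close>
  moreover have "k \<le> card (edges H)"
    using diff_card_le_card_Diff[OF D(1), of "edges G"] D(2) k unfolding H_def by simp
  ultimately show "strong_closure F G k" unfolding strong_closure_def using span by blast
qed

subsection \<open>Timed Hoare triples\<close>

fun loop_free :: "com \<Rightarrow> bool" where
  "loop_free (Seq c1 c2) \<longleftrightarrow> loop_free c1 \<and> loop_free c2"
| "loop_free (Branch e c1 c2) \<longleftrightarrow> loop_free c1 \<and> loop_free c2"
| "loop_free (Loop e c) \<longleftrightarrow> False"
| "loop_free _ \<longleftrightarrow> True"

fun result :: "com \<Rightarrow> state \<Rightarrow> state" where
  "result (Assign b i e) s = update b (eval i s) (eval e s) s"
| "result (Seq c1 c2) s = result c2 (result c1 s)"
| "result (Branch e c1 c2) s = (if eval e s \<noteq> 0 then result c1 s else result c2 s)"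
| "result _ s = s"

text \<open>Adding both branches overestimates, but the value depends on the program text only and
  hence counts as a constant. The value at loops is a dummy.\<close>

fun max_cost :: "com \<Rightarrow> nat" where
  "max_cost (Assign b i e) = 1 + exp_cost i + exp_cost e"
| "max_cost (Seq c1 c2) = max_cost c1 + max_cost c2"
| "max_cost (Branch e c1 c2) = 1 + exp_cost e + max_cost c1 + max_cost c2"
| "max_cost _ = 1"

lemma exec_loop_free: "loop_free c \<Longrightarrow> \<exists>t \<le> max_cost c. exec c s t (result c s)"
proof (induction c arbitrary: s)
  case (Seq c1 c2)
  then obtain t1 t2 where "t1 \<le> max_cost c1" "exec c1 s t1 (result c1 s)"
    "t2 \<le> max_cost c2" "exec c2 (result c1 s) t2 (result c2 (result c1 s))"
    by (metis loop_free.simps(1))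
  then show ?case by (intro exI[of _ "t1 + t2"]) (auto intro: exec.Seq)
next
  case (Branch e c1 c2)
  then obtain t1 t2 where "t1 \<le> max_cost c1" "exec c1 s t1 (result c1 s)"
    "t2 \<le> max_cost c2" "exec c2 s t2 (result c2 s)"
    by (metis loop_free.simps(2))
  then have "eval e s = 0 \<Longrightarrow> exec (Branch e c1 c2) s (1 + exp_cost e + t2) (result c2 s)"
    "eval e s \<noteq> 0 \<Longrightarrow> exec (Branch e c1 c2) s (1 + exp_cost e + t1) (result c1 s)"
    using exec.BranchFalse exec.BranchTrue by blast+
  then show ?case
    using \<open>t1 \<le> max_cost c1\<close> \<open>t2 \<le> max_cost c2\<close>
    by (intro exI[of _ "if eval e s = 0 then 1 + exp_cost e + t2 else 1 + exp_cost e + t1"]) auto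
qed (auto intro: exec.intros exec.Skip[simplified] exec.Assign[simplified])

definition runs :: "(state \<Rightarrow> bool) \<Rightarrow> com \<Rightarrow> nat \<Rightarrow> (state \<Rightarrow> bool) \<Rightarrow> bool" where
  "runs P c T Q \<longleftrightarrow> (\<forall>s. P s \<longrightarrow> (\<exists>t s'. exec c s t s' \<and> t \<le> T \<and> Q s'))"

lemma runs_loop_free:
  assumes "loop_free c" "\<And>s. P s \<Longrightarrow> Q (result c s)" "max_cost c \<le> T"
  shows "runs P c T Q"
  unfolding runs_def using exec_loop_free[OF assms(1)] assms(2,3) order.trans by blast

lemma runs_Seq:
  assumes "runs P c1 T1 Q" "runs Q c2 T2 R"
  shows "runs P (Seq c1 c2) (T1 + T2) R"
  unfolding runs_def
proof (intro allI impI)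
  fix s assume "P s"
  with assms(1) obtain t1 s1 where 1: "exec c1 s t1 s1" "t1 \<le> T1" "Q s1"
    unfolding runs_def by blast
  with assms(2) obtain t2 s2 where 2: "exec c2 s1 t2 s2" "t2 \<le> T2" "R s2"
    unfolding runs_def by blast
  show "\<exists>t s'. exec (Seq c1 c2) s t s' \<and> t \<le> T1 + T2 \<and> R s'"
    using exec.Seq[OF 1(1) 2(1)] 1(2) 2(2,3) add_mono by blast
qed

lemma runs_weaken:
  assumes "runs P c T Q" "\<And>s. P' s \<Longrightarrow> P s" "T \<le> T'" "\<And>s. Q s \<Longrightarrow> Q' s"
  shows "runs P' c T' Q'"
  using assms unfolding runs_def by (meson order.trans)

text \<open>The guard is a truncated difference, nonzero exactly while the counter is below the
  value of \<open>e\<close>.\<close>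

definition For :: "nat \<Rightarrow> exp \<Rightarrow> com \<Rightarrow> com" where
  "For b e c = Seq (Assign b (Const 0) (Const 0))
     (Loop (Sub e (Cell b (Const 0)))
       (Seq c (Assign b (Const 0) (Add (Cell b (Const 0)) (Const 1)))))"

lemma update_apply [simp]:
  "update b i v s b' i' = (if b' = b \<and> i' = i then v else s b' i')"
  unfolding update_def by auto

text \<open>The guard is evaluated anew in each round, so the invariant must fix the value
  \<open>m\<close> of \<open>e\<close>. A round costs at most \<open>T\<close>, plus 6 for the
  increment and \<open>exp_cost e + 4\<close> for the guard; the extra round in \<open>Suc m\<close>
  pays for the initialisation and the last test.\<close>

lemma runs_For:
  assumes init: "\<And>s. P s \<Longrightarrow> I 0 (update b 0 0 s)"
    and bound: "\<And>i s. I i s \<Longrightarrow> s b 0 = i \<and> eval e s = m"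
    and body: "\<And>i. i < m \<Longrightarrow> runs (I i) c T (\<lambda>s. s b 0 = i \<and> I (Suc i) (update b 0 (Suc i) s))"
  shows "runs P (For b e c) (Suc m * (T + exp_cost e + 10)) (I m)"
proof -
  let ?incr = "Assign b (Const 0) (Add (Cell b (Const 0)) (Const 1))"
  let ?loop = "Loop (Sub e (Cell b (Const 0))) (Seq c ?incr)"
  let ?K = "T + exp_cost e + 10"
  have loop: "\<exists>t s'. exec ?loop s t s' \<and> t \<le> (m - i) * ?K + (exp_cost e + 4) \<and> I m s'"
    if "i \<le> m" "I i s" for i s
    using that
  proof (induction i arbitrary: s rule: inc_induct)
    case base
    then have "eval (Sub e (Cell b (Const 0))) s = 0" using bound[OF base.prems] by simp
    from exec.LoopFalse[OF this, of "Seq c ?incr"] base show ?case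
      by (intro exI[of _ "1 + exp_cost (Sub e (Cell b (Const 0)))"] exI[of _ s]) simp
  next
    case (step i)
    from body[OF step.hyps(2)] step.prems obtain t1 s1
      where 1: "exec c s t1 s1" "t1 \<le> T" "s1 b 0 = i" "I (Suc i) (update b 0 (Suc i) s1)"
      unfolding runs_def by blast
    from step.IH[OF 1(4)] obtain t2 s2 where
      2: "exec ?loop (update b 0 (Suc i) s1) t2 s2"
        "t2 \<le> (m - Suc i) * ?K + (exp_cost e + 4)" "I m s2" by blast
    have "exec (Seq c ?incr) s (t1 + 6) (update b 0 (Suc i) s1)"
      using exec.Seq[OF 1(1) exec.Assign[of b "Const 0" "Add (Cell b (Const 0)) (Const 1)" s1]] 1(3)
      by (simp add: eval_nat_numeral)
    moreover have "eval (Sub e (Cell b (Const 0))) s \<noteq> 0"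
      using bound[OF step.prems] step.hyps by simp
    ultimately have "exec ?loop s (1 + exp_cost (Sub e (Cell b (Const 0))) + (t1 + 6) + t2) s2"
      using 2(1) exec.LoopTrue by blast
    moreover have "(m - i) * ?K = ?K + (m - Suc i) * ?K"
      using step.hyps(2) by (metis Suc_diff_Suc mult_Suc)
    ultimately show ?case using 1(2) 2(2,3) by (intro exI conjI) auto
  qed
  show ?thesis
    unfolding runs_def
  proof (intro allI impI)
    fix s assume "P s"
    with loop[of 0 "update b 0 0 s"] init obtain t s' where
      t: "exec ?loop (update b 0 0 s) t s'" "t \<le> m * ?K + (exp_cost e + 4)" "I m s'" by auto
    have "exec (For b e c) s (3 + t) s'"
      unfolding For_def using exec.Seq[OF exec.Assign[of b "Const 0" "Const 0" s]] t(1)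
      by (simp add: eval_nat_numeral)
    moreover have "3 + t \<le> Suc m * ?K" using t(2) by simp
    ultimately show "\<exists>t s'. exec (For b e c) s t s' \<and> t \<le> Suc m * ?K \<and> I m s'"
      using t(3) by blast
  qed
qed

section \<open>Nested loops over all tuples of vertices\<close>

fun nested :: "nat \<Rightarrow> nat \<Rightarrow> com \<Rightarrow> com" where
  "nested j 0 c = c"
| "nested j (Suc r) c = For (15 + j) (Cell 0 (Const 0)) (nested (Suc j) r c)"

definition counters :: "nat list \<Rightarrow> state \<Rightarrow> bool" where
  "counters vs s \<longleftrightarrow> (\<forall>j < length vs. s (15 + j) 0 = vs ! j)"

lemma counters_update: "15 + length vs \<le> b \<Longrightarrow> counters vs (update b i v s) = counters vs s"
  unfolding counters_def by auto

definition tuples :: "nat \<Rightarrow> nat \<Rightarrow> nat list list" where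
  "tuples r n = product_lists (replicate r [0..<n])"

lemma set_tuples: "set (tuples r n) = {vs. length vs = r \<and> set vs \<subseteq> {..<n}}"
  unfolding tuples_def product_lists_set list_all2_conv_all_nth
  by (auto simp: subset_code(1) all_set_conv_all_nth)

lemma fold_concat_map: "fold f (concat (map g xs)) st = fold (\<lambda>x. fold f (g x)) xs st"
  by (induction xs arbitrary: st) auto

lemma fold_tuples_Suc:
  "fold f (tuples (Suc r) n) = fold (\<lambda>v. fold (\<lambda>vs. f (v # vs)) (tuples r n)) [0..<n]"
  by (rule ext) (simp add: tuples_def fold_concat_map fold_map comp_def)

text \<open>\<open>R\<close> relates an abstract value to the machine state, and one execution of
  the body applies \<open>f\<close> to it. The nest thus performs the fold over all completions of
  the prefix \<open>vs\<close>; \<open>indep\<close> protects \<open>R\<close> from changes of the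
  loop counters.\<close>

lemma runs_nested:
  assumes bound: "\<And>st s. R st s \<Longrightarrow> s 0 0 = n"
    and indep: "\<And>st b v s. 15 \<le> b \<Longrightarrow> R st (update b 0 v s) = R st s"
    and body: "\<And>st vs. length vs = q \<Longrightarrow> set vs \<subseteq> {..<n} \<Longrightarrow>
      runs (\<lambda>s. R st s \<and> counters vs s) c T (\<lambda>s. R (f vs st) s \<and> counters vs s)"
    and vs: "length vs + r = q" "set vs \<subseteq> {..<n}"
  shows "runs (\<lambda>s. R st s \<and> counters vs s) (nested (length vs) r c) (Suc n ^ r * (T + r * 12))
    (\<lambda>s. R (fold (\<lambda>ws. f (vs @ ws)) (tuples r n) st) s \<and> counters vs s)"
  using vs
proof (induction r arbitrary: vs st)
  case 0
  then show ?case using body[of vs st] by (simp add: tuples_def)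
next
  case (Suc r)
  let ?g = "\<lambda>v. fold (\<lambda>ws. f (vs @ v # ws)) (tuples r n)"
  let ?b = "15 + length vs"
  let ?I = "\<lambda>i s. (R (fold ?g [0..<i] st) s \<and> counters vs s) \<and> s ?b 0 = i"
  let ?T = "Suc n ^ r * (T + r * 12)"
  have "runs (\<lambda>s. R st s \<and> counters vs s) (nested (length vs) (Suc r) c)
    (Suc n * (?T + exp_cost (Cell 0 (Const 0)) + 10)) (?I n)"
    unfolding nested.simps
  proof (rule runs_For[where I = ?I])
    fix i assume "i < n"
    then have *: "length (vs @ [i]) + r = q" "set (vs @ [i]) \<subseteq> {..<n}" using Suc.prems by auto
    have c: "counters (vs @ [i]) s \<longleftrightarrow> counters vs s \<and> s ?b 0 = i" for s
      unfolding counters_def by (auto simp: nth_append less_Suc_eq)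
    have "runs (\<lambda>s. R (fold ?g [0..<i] st) s \<and> counters (vs @ [i]) s) (nested (Suc (length vs)) r c)
        ?T (\<lambda>s. R (?g i (fold ?g [0..<i] st)) s \<and> counters (vs @ [i]) s)"
      using Suc.IH[OF *, of "fold ?g [0..<i] st"] by simp
    then show "runs (?I i) (nested (Suc (length vs)) r c) ?T
        (\<lambda>s. s ?b 0 = i \<and> ?I (Suc i) (update ?b 0 (Suc i) s))"
      by (rule runs_weaken) (auto simp: c indep counters_update)
  qed (auto simp: indep counters_update bound)
  then show ?case
  proof (rule runs_weaken)
    \<comment> \<open>The overhead 12 of this level is absorbed since \<open>Suc n ^ r\<close> is at
      least 1.\<close>
    have "Suc n * (?T + 12) \<le> Suc n * (?T + Suc n ^ r * 12)" by (intro mult_le_mono2) simp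
    then show "Suc n * (?T + exp_cost (Cell 0 (Const 0)) + 10) \<le> Suc n ^ Suc r * (T + Suc r * 12)"
      by (simp add: algebra_simps)
  qed (auto simp: fold_tuples_Suc)
qed

subsection \<open>The program\<close>

text \<open>
  Use of the banks: 3 holds the row offsets \<open>u * n\<close> of the adjacency matrix, 5 and 6 the tables of
  \<open>j mod B\<close> and \<open>j div B\<close> (the machine has neither multiplication nor division); in cell 0, 7 holds
  the number of edges, 8 the number \<open>N\<close> of choice lists, 9 the current choice list \<open>x\<close>, 10 its
  unused digits, 11 the failure flag, 12 the answer so far, 13 and 14 loop
  counters, \<open>15 + j\<close> entry \<open>j\<close> of the tuple. In bank 4 an edge is marked as deleted by \<open>x + 1\<close>, which
  makes the marks of earlier choice lists void.
\<close>

abbreviation reg :: "nat \<Rightarrow> exp" where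
  "reg b \<equiv> Cell b (Const 0)"

definition sum_exp :: "exp list \<Rightarrow> exp" where
  "sum_exp es = foldr Add es (Const 0)"

text \<open>At least one of the two truncated differences is 0, so their sum is the absolute
  difference.\<close>

definition equal_exp :: "exp \<Rightarrow> exp \<Rightarrow> exp" where
  "equal_exp e1 e2 = Sub (Const 1) (Add (Sub e1 e2) (Sub e2 e1))"

lemma eval_sum_exp [simp]: "eval (sum_exp es) s = sum_list (map (\<lambda>e. eval e s) es)"
  unfolding sum_exp_def by (induction es) auto

lemma eval_equal_exp [simp]: "eval (equal_exp e1 e2) s = (if eval e1 s = eval e2 s then 1 else 0)"
  unfolding equal_exp_def by auto

definition matrix_index :: "nat \<Rightarrow> nat \<Rightarrow> exp" where
  "matrix_index i j = Add (Cell 3 (reg (15 + i))) (reg (15 + j))"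

text \<open>Each expression is designed to vanish iff its pair passes the test in
  \<open>is_copy\<close>. Values being natural numbers, a single sum tests all pairs at
  once.\<close>

definition mismatches :: "nat \<Rightarrow> (nat \<times> nat) list \<Rightarrow> exp list" where
  "mismatches q es = map
    (\<lambda>(i, j). Add (equal_exp (reg (15 + i)) (reg (15 + j)))
      (if (i, j) \<in> set es then Sub (Const 1) (Cell 2 (matrix_index i j))
       else Cell 2 (matrix_index i j)))
    (filter (\<lambda>(i, j). i < j) (List.product [0..<q] [0..<q]))"

definition hits :: "(nat \<times> nat) list \<Rightarrow> exp list" where
  "hits es = map (\<lambda>(i, j). equal_exp (Cell 4 (matrix_index i j)) (Add (reg 9) (Const 1))) es"

text \<open>Both orientations are marked because a later tuple may list the endpoints in either
  order.\<close>

fun delete_edge :: "nat \<Rightarrow> (nat \<times> nat) list \<Rightarrow> com" where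
  "delete_edge d [] = Assign 11 (Const 0) (Const 1)"
| "delete_edge d ((i, j) # es) =
    Branch (equal_exp (Cell 5 (reg 10)) (Const d))
      (Seq (Assign 4 (matrix_index i j) (Add (reg 9) (Const 1)))
        (Assign 4 (matrix_index j i) (Add (reg 9) (Const 1))))
      (delete_edge (Suc d) es)"

text \<open>Machine version of \<open>hit_step\<close>. A nonzero sum means that the tuple is no
  copy or is hit already; the digit is dropped only after \<open>delete_edge\<close> has read
  it.\<close>

definition process_tuple :: "nat \<Rightarrow> (nat \<times> nat) list \<Rightarrow> com" where
  "process_tuple q es =
    Branch (sum_exp (mismatches q es @ hits es)) Skip
      (Seq (delete_edge 1 es) (Assign 10 (Const 0) (Cell 6 (reg 10))))"

definition fill_rows :: com where
  "fill_rows = For 13 (reg 0)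
    (Assign 3 (Add (reg 13) (Const 1)) (Add (Cell 3 (reg 13)) (reg 0)))"

text \<open>The inner loop stays below the diagonal, so each edge is counted once.\<close>

definition count_edges :: com where
  "count_edges = For 13 (reg 0) (For 14 (reg 13)
    (Assign 7 (Const 0) (Add (reg 7) (Cell 2 (Add (Cell 3 (reg 13)) (reg 14))))))"

definition compute_power :: "nat \<Rightarrow> com" where
  "compute_power B = Seq (Assign 8 (Const 0) (Const 1))
    (For 13 (Sub (reg 7) (reg 1)) (Assign 8 (Const 0) (sum_exp (replicate B (reg 8)))))"

text \<open>Counting with carry replaces division: after the digit \<open>B - 1\<close> comes 0, and
  the quotient goes up.\<close>

definition fill_digits :: "nat \<Rightarrow> com" where
  "fill_digits B = For 9 (reg 8)
    (Branch (equal_exp (Add (Cell 5 (reg 9)) (Const 1)) (Const B))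
      (Seq (Assign 5 (Add (reg 9) (Const 1)) (Const 0))
        (Assign 6 (Add (reg 9) (Const 1)) (Add (Cell 6 (reg 9)) (Const 1))))
      (Seq (Assign 5 (Add (reg 9) (Const 1)) (Add (Cell 5 (reg 9)) (Const 1)))
        (Assign 6 (Add (reg 9) (Const 1)) (Cell 6 (reg 9)))))"

definition search :: "nat \<Rightarrow> (nat \<times> nat) list \<Rightarrow> com" where
  "search q es = For 9 (reg 8)
    (Seq (Seq (Assign 10 (Const 0) (reg 9)) (Assign 11 (Const 0) (Const 0)))
      (Seq (nested 0 q (process_tuple q es))
        (Branch (reg 11) Skip (Assign 12 (Const 0) (Const 1)))))"

text \<open>If \<open>k\<close> exceeds the number of edges, the inner difference is positive and
  forces the answer 0; otherwise it is 0 and changes nothing.\<close>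

definition answer :: com where
  "answer = Assign 0 (Const 0) (Sub (reg 12) (Sub (reg 1) (reg 7)))"

definition program :: "nat \<Rightarrow> (nat \<times> nat) list \<Rightarrow> com" where
  "program q es = (let B = 2 ^ Suc (length es) in
    Seq fill_rows (Seq count_edges (Seq (compute_power B) (Seq (fill_digits B)
      (Seq (search q es) answer)))))"

lemma loop_free_delete_edge: "loop_free (delete_edge d es)"
  by (induction d es rule: delete_edge.induct) auto

lemma loop_free_process_tuple: "loop_free (process_tuple q es)"
  unfolding process_tuple_def by (simp add: loop_free_delete_edge)

lemma eval_matrix_index [simp]: "eval (matrix_index i j) s = s 3 (s (15 + i) 0) + s (15 + j) 0"
  unfolding matrix_index_def by simp

lemma result_delete_edge:
  "result (delete_edge d es) s =
    (let c = s 5 (s 10 0) in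
     if d \<le> c \<and> c < d + length es
     then case es ! (c - d) of (i, j) \<Rightarrow>
       update 4 (s 3 (s (15 + j) 0) + s (15 + i) 0) (Suc (s 9 0))
         (update 4 (s 3 (s (15 + i) 0) + s (15 + j) 0) (Suc (s 9 0)) s)
     else update 11 0 1 s)"
proof (induction d es rule: delete_edge.induct)
  case (2 d i j es)
  consider "s 5 (s 10 0) = d" | "s 5 (s 10 0) < d" | c where "s 5 (s 10 0) = Suc d + c"
    by (metis add_Suc less_imp_Suc_add linorder_neqE_nat)
  then show ?case
    using 2 by cases (auto simp: Let_def fun_eq_iff split: prod.splits)
qed (simp add: Let_def fun_eq_iff)

text \<open>Each edge is counted at its larger endpoint.\<close>

lemma card_edges_sum:
  fixes G :: "nat graph"
  assumes "simple_graph G" "verts G = {..<n}"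
  shows "card (edges G) = (\<Sum>u < n. \<Sum>v < u. if {u, v} \<in> edges G then 1 else 0)"
proof -
  let ?P = "SIGMA u : {..<n}. {v \<in> {..<u}. {u, v} \<in> edges G}"
  have inj: "inj_on (\<lambda>(u, v). {u, v}) ?P"
    by (auto simp: inj_on_def doubleton_eq_iff)
  have image: "(\<lambda>(u, v). {u, v}) ` ?P = edges G"
  proof (intro equalityI subsetI)
    fix e assume e: "e \<in> edges G"
    obtain u v where "e = {u, v}" "u \<noteq> v" "u < n" "v < n"
      using edge_obtain[OF assms(1) e] assms(2) by auto
    then obtain u v where "e = {u, v}" "v < u" "u < n"
      by (metis insert_commute linorder_neqE_nat)
    then have "(u, v) \<in> ?P" "e = (\<lambda>(u, v). {u, v}) (u, v)" using e by auto
    then show "e \<in> (\<lambda>(u, v). {u, v}) ` ?P" by (rule rev_image_eqI)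
  qed auto
  have "card (edges G) = card ?P" using card_image[OF inj] unfolding image .
  also have "\<dots> = (\<Sum>u < n. card {v \<in> {..<u}. {u, v} \<in> edges G})" by simp
  also have "\<dots> = (\<Sum>u < n. \<Sum>v < u. if {u, v} \<in> edges G then 1 else 0)"
    by (intro sum.cong) (auto simp: sum.If_cases Int_def)
  finally show ?thesis .
qed

lemma row_index_inj:
  fixes u v n :: nat
  assumes "v < n" "v' < n"
  shows "u * n + v = u' * n + v' \<longleftrightarrow> u = u' \<and> v = v'"
proof
  assume eq: "u * n + v = u' * n + v'"
  have "(u * n + v) div n = u" "(u' * n + v') div n = u'" using assms by auto
  with eq show "u = u' \<and> v = v'" by simp
qed simp

subsection \<open>Correctness and running time\<close>

locale closure_instance =
  fixes F :: "'a graph" and q :: nat and es :: "(nat \<times> nat) list"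
    and G :: "nat graph" and n k :: nat
  assumes simple_F: "simple_graph F" and rep: "represents q es F"
    and simple_G: "simple_graph G" and verts_G: "verts G = {..<n}"
begin

definition B :: nat where "B = 2 ^ Suc (length es)"
definition m :: nat where "m = card (edges G)"
definition N :: nat where "N = B ^ (m - k)"

lemma es_bound: "(i, j) \<in> set es \<Longrightarrow> i < j \<and> j < q"
  using rep unfolding represents_def by auto

lemma B_bounds: "length es < B" "0 < B"
  unfolding B_def using Suc_lessD[OF less_exp[of "Suc (length es)"]] by simp_all

lemma B_simps: "Suc (j mod B) = B \<Longrightarrow> Suc j mod B = 0 \<and> Suc j div B = Suc (j div B)"
  "Suc (j mod B) \<noteq> B \<Longrightarrow> Suc j mod B = Suc (j mod B) \<and> Suc j div B = j div B"
  by (simp_all add: mod_Suc div_Suc)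

lemma N_pos: "0 < N" unfolding N_def using B_bounds by simp

section \<open>State predicates and preprocessing\<close>

definition base :: "state \<Rightarrow> bool" where
  "base s \<longleftrightarrow> s 0 0 = n \<and> s 1 0 = k \<and>
    (\<forall>u < n. \<forall>v < n. s 2 (u * n + v) = (if {u, v} \<in> edges G then 1 else 0))"

lemma base_update [simp]: "2 < b \<Longrightarrow> base (update b i v s) = base s"
  unfolding base_def by simp

definition clear :: "state \<Rightarrow> bool" where
  "clear s \<longleftrightarrow> (\<forall>c. s 4 c = 0) \<and> s 5 0 = 0 \<and> s 6 0 = 0 \<and> s 12 0 = 0"

lemma clear_update [simp]: "b \<notin> {4, 5, 6, 12} \<Longrightarrow> clear (update b i v s) = clear s"
  unfolding clear_def by simp

definition rows :: "nat \<Rightarrow> state \<Rightarrow> bool" where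
  "rows i s \<longleftrightarrow> (\<forall>j \<le> i. s 3 j = j * n)"

lemma rows_update [simp]: "b \<noteq> 3 \<Longrightarrow> rows l (update b i v s) = rows l s"
  unfolding rows_def by simp

lemma base_input: "base (input G k)"
proof -
  have "u * n + v < n * n" if "u < n" "v < n" for u v
  proof -
    have "u * n + v < Suc u * n" using that by simp
    also have "\<dots> \<le> n * n" using that by (intro mult_le_mono1) simp
    finally show ?thesis .
  qed
  then show ?thesis
    using verts_G by (auto simp: base_def input_def Let_def)
qed

lemma runs_fill_rows:
  "runs (\<lambda>s. s = input G k) fill_rows (Suc n * 30)
     (\<lambda>s. base s \<and> clear s \<and> rows n s \<and> s 7 0 = 0)"
proof -
  let ?I = "\<lambda>i s. base s \<and> clear s \<and> rows i s \<and> s 7 0 = 0 \<and> s 13 0 = i"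
  have "runs (\<lambda>s. s = input G k) fill_rows (Suc n * (11 + exp_cost (reg 0) + 10)) (?I n)"
    unfolding fill_rows_def
  proof (rule runs_For[where I = ?I])
    fix s assume "s = input G k"
    then show "?I 0 (update 13 0 0 s)"
      using base_input by (simp add: clear_def rows_def) (simp add: input_def Let_def)
  next
    fix i
    show "runs (?I i) (Assign 3 (Add (reg 13) (Const 1)) (Add (Cell 3 (reg 13)) (reg 0))) 11
        (\<lambda>s. s 13 0 = i \<and> ?I (Suc i) (update 13 0 (Suc i) s))"
      by (rule runs_loop_free) (auto simp: rows_def base_def le_Suc_eq)
  qed (auto simp: base_def)
  then show ?thesis by (rule runs_weaken) auto
qed

lemma runs_count_edges:
  "runs (\<lambda>s. base s \<and> clear s \<and> rows n s \<and> s 7 0 = 0) count_edges (Suc n * (Suc n * 40))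
     (\<lambda>s. base s \<and> clear s \<and> rows n s \<and> s 7 0 = m)"
proof -
  let ?a = "\<lambda>u v. if {u, v} \<in> edges G then 1 else 0 :: nat"
  let ?I = "\<lambda>i s. base s \<and> clear s \<and> rows n s \<and> s 7 0 = (\<Sum>u < i. \<Sum>v < u. ?a u v) \<and> s 13 0 = i"
  have "runs (\<lambda>s. base s \<and> clear s \<and> rows n s \<and> s 7 0 = 0) count_edges
    (Suc n * ((Suc n * 24) + exp_cost (reg 0) + 10)) (?I n)"
    unfolding count_edges_def
  proof (rule runs_For[where I = ?I])
    fix i assume i: "i < n"
    let ?J = "\<lambda>j s. base s \<and> clear s \<and> rows n s \<and>
      s 7 0 = (\<Sum>u < i. \<Sum>v < u. ?a u v) + (\<Sum>v < j. ?a i v) \<and> s 13 0 = i \<and> s 14 0 = j"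
    let ?c = "Assign 7 (Const 0) (Add (reg 7) (Cell 2 (Add (Cell 3 (reg 13)) (reg 14))))"
    have "runs (?I i) (For 14 (reg 13) ?c) (Suc i * (12 + exp_cost (reg 13) + 10)) (?J i)"
    proof (rule runs_For[where I = ?J])
      fix j assume j: "j < i"
      show "runs (?J j) ?c 12 (\<lambda>s. s 14 0 = j \<and> ?J (Suc j) (update 14 0 (Suc j) s))"
        by (rule runs_loop_free) (use i j in \<open>auto simp: rows_def base_def\<close>)
    qed auto
    then show "runs (?I i) (For 14 (reg 13) ?c) (Suc n * 24)
        (\<lambda>s. s 13 0 = i \<and> ?I (Suc i) (update 13 0 (Suc i) s))"
      by (rule runs_weaken) (use i in auto)
  qed (auto simp: base_def)
  then show ?thesis
    by (rule runs_weaken) (auto simp: m_def card_edges_sum[OF simple_G verts_G] algebra_simps)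
qed

lemma runs_compute_power:
  "runs (\<lambda>s. base s \<and> clear s \<and> rows n s \<and> s 7 0 = m) (compute_power B)
     (Suc (m - k) * (exp_cost (sum_exp (replicate B (reg 8))) + 20) + 20)
     (\<lambda>s. base s \<and> clear s \<and> rows n s \<and> s 7 0 = m \<and> s 8 0 = N)"
proof -
  let ?I = "\<lambda>i s. base s \<and> clear s \<and> rows n s \<and> s 7 0 = m \<and> s 8 0 = B ^ i \<and> s 13 0 = i"
  let ?c = "Assign 8 (Const 0) (sum_exp (replicate B (reg 8)))"
  have 1: "runs (\<lambda>s. base s \<and> clear s \<and> rows n s \<and> s 7 0 = m) (Assign 8 (Const 0) (Const 1)) 3
    (\<lambda>s. base s \<and> clear s \<and> rows n s \<and> s 7 0 = m \<and> s 8 0 = 1)"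
    by (rule runs_loop_free) auto
  have 2: "runs (\<lambda>s. base s \<and> clear s \<and> rows n s \<and> s 7 0 = m \<and> s 8 0 = 1)
    (For 13 (Sub (reg 7) (reg 1)) ?c)
    (Suc (m - k) * (max_cost ?c + exp_cost (Sub (reg 7) (reg 1)) + 10)) (?I (m - k))"
  proof (rule runs_For[where I = ?I])
    fix i
    show "runs (?I i) ?c (max_cost ?c) (\<lambda>s. s 13 0 = i \<and> ?I (Suc i) (update 13 0 (Suc i) s))"
      by (rule runs_loop_free) (auto simp: sum_list_replicate)
  qed (auto simp: base_def)
  show ?thesis
    unfolding compute_power_def
    by (rule runs_weaken[OF runs_Seq[OF 1 2]]) (auto simp: N_def algebra_simps)
qed

definition env :: "state \<Rightarrow> bool" where
  "env s \<longleftrightarrow> base s \<and> rows n s \<and> s 7 0 = m \<and> s 8 0 = N \<and>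
    (\<forall>j \<le> N. s 5 j = j mod B \<and> s 6 j = j div B)"

lemma env_update [simp]: "2 < b \<Longrightarrow> b \<notin> {3, 5, 6, 7, 8} \<Longrightarrow> env (update b i v s) = env s"
  unfolding env_def by simp

lemma runs_fill_digits:
  "runs (\<lambda>s. base s \<and> clear s \<and> rows n s \<and> s 7 0 = m \<and> s 8 0 = N) (fill_digits B)
     (Suc N * 70) (\<lambda>s. env s \<and> (\<forall>c. s 4 c = 0) \<and> s 12 0 = 0)"
proof -
  let ?I = "\<lambda>i s. base s \<and> rows n s \<and> s 7 0 = m \<and> s 8 0 = N \<and>
    (\<forall>j \<le> i. s 5 j = j mod B \<and> s 6 j = j div B) \<and> (\<forall>c. s 4 c = 0) \<and> s 12 0 = 0 \<and> s 9 0 = i"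
  have "runs (\<lambda>s. base s \<and> clear s \<and> rows n s \<and> s 7 0 = m \<and> s 8 0 = N) (fill_digits B)
     (Suc N * (58 + exp_cost (reg 8) + 10)) (?I N)"
    unfolding fill_digits_def
  proof (rule runs_For[where I = ?I], goal_cases)
    case (3 i)
    show ?case
      by (rule runs_loop_free) (auto simp: le_Suc_eq B_simps equal_exp_def)
  qed (auto simp: clear_def)
  then show ?thesis by (rule runs_weaken) (auto simp: env_def)
qed

section \<open>Simulation of one tuple\<close>

definition process :: "nat list \<Rightarrow> nat \<times> nat set set \<times> bool \<Rightarrow> nat \<times> nat set set \<times> bool" where
  "process vs = (if is_copy q es G vs then hit_step B (copy_edges es vs) else id)"

text \<open>The bound \<open>y \<le> x\<close> keeps look-ups inside the tables. No mark exceeds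
  \<open>Suc x\<close>, so none can be mistaken for a mark of a later choice list.\<close>

fun encodes :: "nat \<Rightarrow> nat \<Rightarrow> nat \<times> nat set set \<times> bool \<Rightarrow> state \<Rightarrow> bool" where
  "encodes x a (y, D, failed) s \<longleftrightarrow> env s \<and> x < N \<and> y \<le> x \<and> s 9 0 = x \<and> s 10 0 = y \<and>
    s 11 0 = (if failed then 1 else 0) \<and> s 12 0 = a \<and> (\<forall>c. s 4 c \<le> Suc x) \<and>
    (\<forall>u < n. \<forall>v < n. s 4 (u * n + v) = Suc x \<longleftrightarrow> {u, v} \<in> D)"

lemma encodes_update: "12 < b \<Longrightarrow> encodes x a st (update b i v s) = encodes x a st s"
  by (cases st) simp

context
  fixes vs :: "nat list" and s :: state
  assumes vs: "length vs = q" "set vs \<subseteq> {..<n}" and env: "env s" and counters: "counters vs s"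
begin

lemma nth_vs: "j < q \<Longrightarrow> vs ! j < n"
  using vs nth_mem by blast

lemma counter: "j < q \<Longrightarrow> s (15 + j) 0 = vs ! j"
  using counters vs unfolding counters_def by simp

lemma row: "u < n \<Longrightarrow> s 3 u = u * n"
  using env unfolding env_def rows_def by simp

lemma matrix: "u < n \<Longrightarrow> v < n \<Longrightarrow> s 2 (u * n + v) = (if {u, v} \<in> edges G then 1 else 0)"
  using env unfolding env_def base_def by simp

lemma mismatches_iff: "(\<forall>e \<in> set (mismatches q es). eval e s = 0) \<longleftrightarrow> is_copy q es G vs"
proof -
  have "(\<forall>e \<in> set (mismatches q es). eval e s = 0) \<longleftrightarrow>
    (\<forall>i j. i < j \<and> j < q \<longrightarrow> eval (Add (equal_exp (reg (15 + i)) (reg (15 + j)))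
      (if (i, j) \<in> set es then Sub (Const 1) (Cell 2 (matrix_index i j))
       else Cell 2 (matrix_index i j))) s = 0)"
    unfolding mismatches_def by fastforce
  also have "\<dots> \<longleftrightarrow> is_copy q es G vs"
    unfolding is_copy_def
    by (intro all_cong1) (auto simp: counter row matrix nth_vs)
  finally show ?thesis .
qed

lemma hits_iff:
  assumes "\<forall>u < n. \<forall>v < n. s 4 (u * n + v) = Suc (s 9 0) \<longleftrightarrow> {u, v} \<in> D"
  shows "(\<forall>e \<in> set (hits es). eval e s = 0) \<longleftrightarrow> set (copy_edges es vs) \<inter> D = {}"
proof -
  have "eval (equal_exp (Cell 4 (matrix_index i j)) (Add (reg 9) (Const 1))) s = 0 \<longleftrightarrow>
      {vs ! i, vs ! j} \<notin> D" if "(i, j) \<in> set es" for i j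
    using that es_bound[OF that] assms by (simp add: counter row nth_vs)
  then show ?thesis unfolding hits_def copy_edges_def by fastforce
qed

lemma result_process_tuple:
  assumes "encodes x a st s"
  shows "encodes x a (process vs st) (result (process_tuple q es) s) \<and>
    counters vs (result (process_tuple q es) s)"
proof -
  obtain y D failed where st: "st = (y, D, failed)" by (cases st)
  have D: "\<forall>u < n. \<forall>v < n. s 4 (u * n + v) = Suc (s 9 0) \<longleftrightarrow> {u, v} \<in> D"
    using assms st by simp
  have test: "eval (sum_exp (mismatches q es @ hits es)) s = 0 \<longleftrightarrow>
      is_copy q es G vs \<and> set (copy_edges es vs) \<inter> D = {}"
    using mismatches_iff hits_iff[OF D] by auto
  show ?thesis
  proof (cases "is_copy q es G vs \<and> set (copy_edges es vs) \<inter> D = {}")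
    case False
    then have "process vs st = st" unfolding process_def st by auto
    with False test show ?thesis using assms counters by (simp add: process_tuple_def)
  next
    case True
    have y: "y \<le> x" "x < N" "s 9 0 = x" "s 10 0 = y" using assms st by auto
    then have digit: "s 5 y = y mod B" "s 6 y = y div B" "y div B \<le> x"
      using env unfolding env_def by (auto intro: order.trans[OF div_le_dividend])
    \<comment> \<open>\<open>delete_edge\<close> writes only to banks 4 and 11, so the quotient is
      still looked up at the old \<open>y\<close>.\<close>
    have res: "result (process_tuple q es) s =
      update 10 0 (y div B) (result (delete_edge 1 es) s)"
      using True test y digit
      by (auto simp: process_tuple_def result_delete_edge Let_def split: prod.splits)
    show ?thesis
    proof (cases "1 \<le> y mod B \<and> y mod B \<le> length es")
      case False
      then have "process vs st = (y div B, D, True)"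
        using True unfolding process_def st by (auto simp: copy_edges_def)
      moreover have "result (process_tuple q es) s = update 10 0 (y div B) (update 11 0 1 s)"
        using res False by (auto simp: result_delete_edge Let_def y digit)
      ultimately show ?thesis using assms st counters digit by (simp add: counters_def)
    next
      case digit_ok: True
      obtain i j where ij: "es ! (y mod B - 1) = (i, j)" by fastforce
      have "(i, j) \<in> set es" using digit_ok ij nth_mem[of "y mod B - 1" es] by auto
      then have less: "i < q" "j < q" using es_bound by fastforce+
      then have less_n: "vs ! i < n" "vs ! j < n" using nth_vs by auto
      have "process vs st = (y div B, insert {vs ! i, vs ! j} D, failed)"
        using True digit_ok ij unfolding process_def st by (auto simp: copy_edges_def)
      moreover have "result (process_tuple q es) s = update 10 0 (y div B)
          (update 4 (vs ! j * n + vs ! i) (Suc x) (update 4 (vs ! i * n + vs ! j) (Suc x) s))"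
        using res digit_ok ij by (simp add: result_delete_edge Let_def y digit counter row less less_n)
      \<comment> \<open>Row-major addresses are injective, so only the two cells of the new edge
        receive the mark; this matches equality of unordered pairs.\<close>
      ultimately show ?thesis using assms st counters digit less_n
        by (auto simp: counters_def row_index_inj doubleton_eq_iff)
    qed
  qed
qed

end

section \<open>Search over all choice lists\<close>

definition accepts :: "nat \<Rightarrow> bool" where
  "accepts x \<longleftrightarrow> \<not> snd (snd (fold process (tuples q n) (x, {}, False)))"

lemma runs_nested_process:
  "runs (encodes x a st) (nested 0 q (process_tuple q es))
    (Suc n ^ q * (max_cost (process_tuple q es) + q * 12))
    (encodes x a (fold process (tuples q n) st))"
proof -
  have "runs (\<lambda>s. encodes x a st s \<and> counters [] s) (nested (length ([] :: nat list)) q (process_tuple q es))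
    (Suc n ^ q * (max_cost (process_tuple q es) + q * 12))
    (\<lambda>s. encodes x a (fold (\<lambda>vs. process ([] @ vs)) (tuples q n) st) s \<and> counters [] s)"
  proof (rule runs_nested[where R = "encodes x a" and f = process and q = q])
    show "runs (\<lambda>s. encodes x a st s \<and> counters vs s) (process_tuple q es)
        (max_cost (process_tuple q es)) (\<lambda>s. encodes x a (process vs st) s \<and> counters vs s)"
      if "length vs = q" "set vs \<subseteq> {..<n}" for st vs
    proof (rule runs_loop_free[OF loop_free_process_tuple])
      fix s assume "encodes x a st s \<and> counters vs s"
      moreover from this have "env s" by (cases st) simp
      ultimately show "encodes x a (process vs st) (result (process_tuple q es) s) \<and>
          counters vs (result (process_tuple q es) s)"
        using result_process_tuple that by blast
    qed simp
    show "s 0 0 = n" if "encodes x a st s" for st s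
      using that by (cases st) (simp add: env_def base_def)
  qed (simp_all add: encodes_update)
  then show ?thesis by (simp add: counters_def)
qed

lemma runs_search:
  "runs (\<lambda>s. env s \<and> (\<forall>c. s 4 c = 0) \<and> s 12 0 = 0) (search q es)
    (Suc N * (Suc n ^ q * (max_cost (process_tuple q es) + q * 12) + 40))
    (\<lambda>s. env s \<and> s 12 0 = (if \<exists>x < N. accepts x then 1 else 0))"
proof -
  let ?T = "Suc n ^ q * (max_cost (process_tuple q es) + q * 12)"
  let ?a = "\<lambda>i. if \<exists>x < i. accepts x then 1 else 0 :: nat"
  let ?I = "\<lambda>i s. env s \<and> (\<forall>c. s 4 c \<le> i) \<and> s 12 0 = ?a i \<and> s 9 0 = i"
  let ?init = "Seq (Assign 10 (Const 0) (reg 9)) (Assign 11 (Const 0) (Const 0))"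
  let ?final = "Branch (reg 11) Skip (Assign 12 (Const 0) (Const 1))"
  have "runs (\<lambda>s. env s \<and> (\<forall>c. s 4 c = 0) \<and> s 12 0 = 0) (search q es)
    (Suc N * ((7 + (?T + 7)) + exp_cost (reg 8) + 10)) (?I N)"
    unfolding search_def
  proof (rule runs_For[where I = ?I], goal_cases)
    case (3 i)
    let ?st = "fold process (tuples q n) (i, {}, False)"
    show ?case
    proof (intro runs_Seq)
      show "runs (?I i) ?init 7 (encodes i (?a i) (i, {}, False))"
      proof (rule runs_loop_free)
        fix s assume "?I i s"
        \<comment> \<open>Old marks are at most \<open>i\<close>, so none equals
          \<open>Suc i\<close>: the empty deletion set is encoded without clearing bank 4.\<close>
        moreover from this have "s 4 c \<noteq> Suc i" "s 4 c \<le> Suc i" for c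
          by (metis Suc_n_not_le_n, metis le_SucI)
        ultimately show "encodes i (?a i) (i, {}, False) (result ?init s)" using 3 by simp
      qed auto
      show "runs (encodes i (?a i) (i, {}, False)) (nested 0 q (process_tuple q es)) ?T
          (encodes i (?a i) ?st)" by (rule runs_nested_process)
      show "runs (encodes i (?a i) ?st) ?final 7
          (\<lambda>s. s 9 0 = i \<and> ?I (Suc i) (update 9 0 (Suc i) s))"
      proof (rule runs_loop_free)
        fix s assume s: "encodes i (?a i) ?st s"
        have "accepts i \<longleftrightarrow> s 11 0 = 0" using s unfolding accepts_def by (cases ?st) auto
        moreover have "env s" "s 12 0 = ?a i" "s 9 0 = i" "\<forall>c. s 4 c \<le> Suc i"
          using s by (cases ?st; simp)+
        ultimately show "result ?final s 9 0 = i \<and> ?I (Suc i) (update 9 0 (Suc i) (result ?final s))"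
          by (auto simp: less_Suc_eq)
      qed auto
    qed
  qed (auto simp: env_def)
  then show ?thesis by (rule runs_weaken) (auto simp: algebra_simps)
qed

lemma accepts_iff: "(\<exists>x < N. accepts x) \<and> k \<le> m \<longleftrightarrow> strong_closure F G k"
proof -
  let ?hs = "map (copy_edges es) (filter (is_copy q es G) (tuples q n))"
  \<comment> \<open>Tuples that are not copies act as the identity; filtering them out leaves a
    \<open>hit_step\<close> run over the edge sets of all copies.\<close>
  have "fold process (tuples q n) = fold (hit_step B) ?hs"
    unfolding process_def by (simp add: fold_map fold_filter comp_def)
  then have "(\<exists>x < N. accepts x) \<longleftrightarrow>
    (\<exists>x < B ^ (m - k). \<not> snd (snd (fold (hit_step B) ?hs (x, {}, False))))"
    unfolding accepts_def N_def by simp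
  also have "\<dots> \<longleftrightarrow> (\<exists>D. finite D \<and> card D \<le> m - k \<and> (\<forall>h \<in> set ?hs. set h \<inter> D \<noteq> {}))"
    by (rule bounded_hitting_set_iff) (use B_bounds in \<open>auto simp: copy_edges_def\<close>)
  finally show ?thesis
    unfolding strong_closure_iff_hitting_set[OF simple_G simple_F rep] m_def[symmetric]
    by (auto simp: set_tuples verts_G)
qed

lemma runs_answer:
  "runs (\<lambda>s. env s \<and> s 12 0 = (if \<exists>x < N. accepts x then 1 else 0)) answer 10
    (\<lambda>s. s 0 0 = (if strong_closure F G k then 1 else 0))"
  unfolding answer_def
  by (rule runs_loop_free) (auto simp: env_def base_def accepts_iff[symmetric])

lemma runs_program:
  "runs (\<lambda>s. s = input G k) (program q es)
    (Suc n * 30 + (Suc n * (Suc n * 40) +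
      (Suc (m - k) * (exp_cost (sum_exp (replicate B (reg 8))) + 20) + 20 + (Suc N * 70 +
        (Suc N * (Suc n ^ q * (max_cost (process_tuple q es) + q * 12) + 40) + 10)))))
    (\<lambda>s. s 0 0 = (if strong_closure F G k then 1 else 0))"
  unfolding program_def Let_def B_def[symmetric]
  by (rule runs_Seq[OF runs_fill_rows runs_Seq[OF runs_count_edges runs_Seq[OF runs_compute_power
      runs_Seq[OF runs_fill_digits runs_Seq[OF runs_search runs_answer]]]]])

text \<open>\<open>c\<close> and \<open>w\<close> stand for costs determined by \<open>F\<close>.
  The exponent \<open>q + 2\<close> covers both the quadratic preprocessing and the
  \<open>q\<close>-tuples, so every summand is at most a constant multiple of
  \<open>M\<close>.\<close>

lemma program_time:
  "Suc n * 30 + (Suc n * (Suc n * 40) +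
      (Suc (m - k) * (c + 20) + 20 + (Suc N * 70 + (Suc N * (Suc n ^ q * w + 40) + 10))))
    \<le> (400 + c + 2 * w) * 2 ^ (q + 2) * 2 ^ (Suc (length es) * (m - k)) * max 1 n ^ (q + 2)"
    (is "?t \<le> _")
proof -
  define M where "M = N * Suc n ^ (q + 2)"
  have N: "N = 2 ^ (Suc (length es) * (m - k))" unfolding N_def B_def by (rule power_mult[symmetric])
  \<comment> \<open>The linear number of rounds in computing the power is bounded by the power
    itself.\<close>
  have "Suc (m - k) \<le> 2 ^ (m - k)" by (rule Suc_leI[OF less_exp])
  also have "\<dots> \<le> N" unfolding N by (intro power_increasing) auto
  finally have l: "Suc (m - k) \<le> N" .
  have scale: "x * y \<le> M" if "x \<le> N" "y \<le> Suc n ^ (q + 2)" for x y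
    unfolding M_def using that by (rule mult_le_mono)
  have "Suc n ^ i \<le> Suc n ^ (q + 2)" if "i \<le> q + 2" for i
    using that by (intro power_increasing) auto
  from this[of 0] this[of 1] this[of 2] this[of q]
  have "1 \<le> Suc n ^ (q + 2)" "Suc n ^ 1 \<le> Suc n ^ (q + 2)" "Suc n ^ 2 \<le> Suc n ^ (q + 2)"
    "Suc n ^ q \<le> Suc n ^ (q + 2)"
    by simp_all
  then have bounds: "Suc n \<le> M" "Suc n * Suc n \<le> M" "Suc (m - k) \<le> M" "N \<le> M" "N * Suc n ^ q \<le> M"
      "Suc n ^ q \<le> M" "1 \<le> M"
    using scale[of 1 "Suc n"] scale[of 1 "Suc n * Suc n"] scale[of "Suc (m - k)" 1] scale[of N 1]
      scale[of N "Suc n ^ q"] scale[of 1 "Suc n ^ q"] scale[of 1 1] l N_pos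
    by (simp_all add: power2_eq_square)
  have "?t = 30 * Suc n + 40 * (Suc n * Suc n) + 20 * Suc (m - k) + c * Suc (m - k) + 110 * N + 140
      + w * (N * Suc n ^ q) + w * Suc n ^ q"
    by (simp add: algebra_simps)
  also have "\<dots> \<le> 30 * M + 40 * M + 20 * M + c * M + 110 * M + 140 * M + w * M + w * M"
    using bounds by (intro add_mono mult_le_mono2) auto
  also have "\<dots> \<le> (400 + c + 2 * w) * M" by (simp add: algebra_simps)
  \<comment> \<open>From \<open>Suc n \<le> 2 * max 1 n\<close>; the factor
    \<open>2 ^ (q + 2)\<close> then joins the constant. The maximum keeps the bound positive for the
    empty graph.\<close>
  also have "\<dots> \<le> (400 + c + 2 * w) * (N * (2 * max 1 n) ^ (q + 2))"
    unfolding M_def by (intro mult_le_mono2 power_mono) auto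
  also have "\<dots> = (400 + c + 2 * w) * 2 ^ (q + 2) * N * max 1 n ^ (q + 2)"
    by (simp only: power_mult_distrib mult_ac)
  finally show ?thesis unfolding N .
qed

end

theorem theorem14:
  fixes F :: "'a graph"
  assumes "simple_graph F"
  shows "\<exists>P C a b. decides_within P (strong_closure F)
           (\<lambda>G k. C * 2 ^ (a * (card (edges G) - k)) * (max 1 (card (verts G))) ^ b)"
proof -
  \<comment> \<open>Program and constants are chosen from \<open>F\<close> alone, before
    \<open>G\<close> and \<open>k\<close>; the factor \<open>Suc (length es)\<close> in the exponent
    is the binary logarithm of the base \<open>B\<close>.\<close>
  obtain q es where rep: "represents q es F" using represents_exists[OF assms] by blast
  let ?c = "exp_cost (sum_exp (replicate (2 ^ Suc (length es)) (reg 8)))"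
  let ?w = "max_cost (process_tuple q es) + q * 12"
  let ?C = "(400 + ?c + 2 * ?w) * 2 ^ (q + 2)"
  have "decides_within (program q es) (strong_closure F)
    (\<lambda>G k. ?C * 2 ^ (Suc (length es) * (card (edges G) - k)) * max 1 (card (verts G)) ^ (q + 2))"
    unfolding decides_within_def
  proof (intro allI impI)
    fix G :: "nat graph" and k
    assume G: "simple_graph G \<and> verts G = {..<card (verts G)}"
    interpret closure_instance F q es G "card (verts G)" k
      by standard (use assms rep G in auto)
    show "\<exists>t s. exec (program q es) (input G k) t s \<and>
        s 0 0 = (if strong_closure F G k then 1 else 0) \<and>
        t \<le> ?C * 2 ^ (Suc (length es) * (card (edges G) - k)) * max 1 (card (verts G)) ^ (q + 2)"
      using runs_program order.trans[OF _ program_time[of ?c ?w]]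
      unfolding runs_def m_def B_def by blast
  qed
  then show ?thesis by blast
qed

end
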